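(* Let $(\mathbf{X},\mathbf{T})$ be a nonautonomous dynamical system, and let $\mathbf{d}=\{d_k\}_{k=0}^\infty$ and $\mathbf{d}'=\{d_k'\}_{k=0}^\infty$ be two sequences of metrics such that, for each $k\ge0$, $d_k$ and $d_k'$ induce the same topology on $X_k$. If $\mathbf{d}$ and $\mathbf{d}'$ are uniformly equivalent, then for all equicontinuous $\mathbf{f}\in\mathbf{C}(\mathbf{X},\mathbb{R})$ and all $Z\subset X_0$, $$P^{\mathrm{B}}_{\mathbf{d}}(\mathbf{T},\mathbf{f},Z)=P^{\mathrm{B}}_{\mathbf{d}'}(\mathbf{T},\mathbf{f},Z),\qquad P^{\mathrm{P}}_{\mathbf{d}}(\mathbf{T},\mathbf{f},Z)=P^{\mathrm{P}}_{\mathbf{d}'}(\mathbf{T},\mathbf{f},Z).$$ In particular, $h^{\mathrm{B}}_{\mathbf{d}}(\mathbf{T},Z)=h^{\mathrm{B}}_{\mathbf{d}'}(\mathbf{T},Z)$ and $h^{\mathrm{P}}_{\mathbf{d}}(\mathbf{T},Z)=h^{\mathrm{P}}_{\mathbf{d}'}(\mathbf{T},Z)$.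
   Context: A nonautonomous dynamical system (NDS) $(\mathbf{X},\mathbf{T})$ consists of a sequence $\mathbf{X}=\{X_k\}_{k=0}^\infty$ of compact metrizable spaces, $X_k$ carrying a metric $d_k$, and a sequence $\mathbf{T}=\{T_k\}_{k=0}^\infty$ of continuous maps $T_k:X_k\to X_{k+1}$. Subscripts $\mathbf{d}$, $\mathbf{d}'$ indicate which sequence of metrics is used in the definitions below. The sequences $\mathbf{d}$ and $\mathbf{d}'$ are uniformly equivalent if both sequences of identity maps $\{\mathrm{id}:(X_k,d_k)\to(X_k,d_k')\}_{k\ge0}$ and $\{\mathrm{id}:(X_k,d_k')\to(X_k,d_k)\}_{k\ge0}$ are equicontinuous, i.e. for every $\varepsilon>0$ there is $\delta>0$ such that for all $k\ge 0$ and $x,y\in X_k$, $d_k(x,y)<\delta$ implies $d_k'(x,y)<\varepsilon$, and likewise with $d_k,d_k'$ exchanged. Put $\mathbf{T}^0=\mathrm{id}_{X_0}$, $\mathbf{T}^j=T_{j-1}\circ\cdots\circ T_0:X_0\to X_j$. For $n\ge1$, $x,y\in X_0$ let $d_n^{\mathbf{T}}(x,y)=\max_{0\le j\le n-1}d_j(\mathbf{T}^jx,\mathbf{T}^jy)$; for $\varepsilon>0$ let $B_n^{\mathbf{T}}(x,\varepsilon)$, $\overline{B}_n^{\mathbf{T}}(x,\varepsilon)$ be the sets of $y\in X_0$ with $d_n^{\mathbf{T}}(x,y)<\varepsilon$, respectively $\le\varepsilon$. $\mathbf{C}(\mathbf{X},\mathbb{R})=\prod_{k\ge0}C(X_k,\mathbb{R})$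 is the set of sequences $\mathbf{f}=\{f_k\}$ of continuous functions $f_k:X_k\to\mathbb{R}$; $\mathbf{f}$ is equicontinuous if for every $\varepsilon>0$ there is $\delta>0$ such that for all $k\ge0$ and $x',x''\in X_k$ with $d_k(x',x'')<\delta$, $|f_k(x')-f_k(x'')|<\varepsilon$ (for uniformly equivalent $\mathbf{d},\mathbf{d}'$ this is the same notion for either). Put $S_n^{\mathbf{T}}\mathbf{f}=\sum_{j=0}^{n-1}f_j\circ\mathbf{T}^j$; $\mathbf{0}$ is the sequence of zero functions. Bowen pressure: for $Z\subset X_0$, an $(N,\varepsilon)$-cover of $Z$ is a family $\{B_{n_i}^{\mathbf{T}}(x_i,\varepsilon)\}_i$ with $x_i\in X_0$ and integers $n_i\ge N$ whose union contains $Z$. For $s\in\mathbb{R}$, $N,\varepsilon>0$ let $\mathscr{R}_{N,\varepsilon}^{s}(\mathbf{T},\mathbf{f},Z)=\inf\sum_i\exp(-n_is+S_{n_i}^{\mathbf{T}}\mathbf{f}(x_i))$ over all countable (finite or infinite) $(N,\varepsilon)$-covers of $Z$; $\mathscr{R}_{\varepsilon}^{s}=\lim_{N\to\infty}\mathscr{R}_{N,\varepsilon}^{s}$; $P^{\mathrm{B}}(\mathbf{T},\mathbf{f},Z,\varepsilon)=\inf\{s:\mathscr{R}_{\varepsilon}^{s}(\mathbf{T},\mathbf{f},Z)=0\}$; $P^{\mathrm{B}}(\mathbf{T},\mathbf{f},Z)=\lim_{\varepsilon\to0}P^{\mathrm{B}}(\mathbf{T},\mathbf{f},Z,\varepsilon)$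 (monotone limit). Bowen entropy: $h^{\mathrm{B}}(\mathbf{T},Z)=P^{\mathrm{B}}(\mathbf{T},\mathbf{0},Z)$. Packing pressure: an $(N,\varepsilon)$-packing of $Z$ is a family of pairwise disjoint closed Bowen balls $\{\overline{B}_{n_i}^{\mathbf{T}}(x_i,\varepsilon)\}_i$ with $x_i\in Z$ and integers $n_i\ge N$. Let $\mathscr{P}_{N,\varepsilon}^{s}(\mathbf{T},\mathbf{f},Z)=\sup\sum_i\exp(-n_is+S_{n_i}^{\mathbf{T}}\mathbf{f}(x_i))$ over all countable (finite or infinite) $(N,\varepsilon)$-packings of $Z$; $\mathscr{P}_{\infty,\varepsilon}^{s}=\lim_{N\to\infty}\mathscr{P}_{N,\varepsilon}^{s}$; $\mathscr{P}_{\varepsilon}^{s}(\mathbf{T},\mathbf{f},Z)=\inf\{\sum_{i=1}^\infty\mathscr{P}_{\infty,\varepsilon}^{s}(\mathbf{T},\mathbf{f},Z_i):\bigcup_iZ_i\supseteq Z\}$; $P^{\mathrm{P}}(\mathbf{T},\mathbf{f},Z,\varepsilon)=\inf\{s:\mathscr{P}_{\varepsilon}^{s}(\mathbf{T},\mathbf{f},Z)=0\}$; $P^{\mathrm{P}}(\mathbf{T},\mathbf{f},Z)=\lim_{\varepsilon\to0}P^{\mathrm{P}}(\mathbf{T},\mathbf{f},Z,\varepsilon)$ (monotone limit). Packing entropy: $h^{\mathrm{P}}(\mathbf{T},Z)=P^{\mathrm{P}}(\mathbf{T},\mathbf{0},Z)$. *)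

theory Defs
  imports "HOL-Analysis.Analysis"
begin

text \<open>
  All spaces \<open>X k\<close> live on subsets of one ambient type \<open>'a\<close>, as carriers of abstract topologies;
  the maps \<open>T k\<close> and functions \<open>f k\<close> are total, but only their values on \<open>topspace (X k)\<close> matter.
\<close>

definition nds :: "(nat \<Rightarrow> 'a topology) \<Rightarrow> (nat \<Rightarrow> 'a \<Rightarrow> 'a) \<Rightarrow> bool" where
  "nds X T \<longleftrightarrow>
     (\<forall>k. compact_space (X k) \<and> metrizable_space (X k)) \<and>
     (\<forall>k. continuous_map (X k) (X (Suc k)) (T k))"

definition metrics_for :: "(nat \<Rightarrow> 'a topology) \<Rightarrow> (nat \<Rightarrow> 'a metric) \<Rightarrow> bool" where
  "metrics_for X d \<longleftrightarrow> (\<forall>k. mtopology_of (d k) = X k)"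

definition equicontinuous_maps ::
    "(nat \<Rightarrow> 'a metric) \<Rightarrow> (nat \<Rightarrow> 'b metric) \<Rightarrow> (nat \<Rightarrow> 'a \<Rightarrow> 'b) \<Rightarrow> bool" where
  "equicontinuous_maps d e F \<longleftrightarrow>
     (\<forall>\<epsilon>>0. \<exists>\<delta>>0. \<forall>k. \<forall>x\<in>mspace (d k). \<forall>y\<in>mspace (d k).
        mdist (d k) x y < \<delta> \<longrightarrow> mdist (e k) (F k x) (F k y) < \<epsilon>)"

definition uniformly_equivalent :: "(nat \<Rightarrow> 'a metric) \<Rightarrow> (nat \<Rightarrow> 'a metric) \<Rightarrow> bool" where
  "uniformly_equivalent d d' \<longleftrightarrow>
     equicontinuous_maps d d' (\<lambda>k. id) \<and> equicontinuous_maps d' d (\<lambda>k. id)"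

definition cont_seqs :: "(nat \<Rightarrow> 'a topology) \<Rightarrow> (nat \<Rightarrow> 'a \<Rightarrow> real) set" where
  "cont_seqs X = {f. \<forall>k. continuous_map (X k) euclideanreal (f k)}"

definition equicontinuous_seq :: "(nat \<Rightarrow> 'a metric) \<Rightarrow> (nat \<Rightarrow> 'a \<Rightarrow> real) \<Rightarrow> bool" where
  "equicontinuous_seq d f \<longleftrightarrow> equicontinuous_maps d (\<lambda>k. euclidean_metric) f"

primrec orbit_map :: "(nat \<Rightarrow> 'a \<Rightarrow> 'a) \<Rightarrow> nat \<Rightarrow> 'a \<Rightarrow> 'a" where
  "orbit_map T 0 = id"
| "orbit_map T (Suc j) = T j \<circ> orbit_map T j"

definition birkhoff_sum ::
    "(nat \<Rightarrow> 'a \<Rightarrow> 'a) \<Rightarrow> (nat \<Rightarrow> 'a \<Rightarrow> real) \<Rightarrow> nat \<Rightarrow> 'a \<Rightarrow> real" where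
  "birkhoff_sum T f n x = (\<Sum>j<n. f j (orbit_map T j x))"

text \<open>
  Meaningful for \<open>n \<ge> 1\<close> only. The value for \<open>n = 0\<close> can enter only for \<open>N = 0\<close> in the covers and
  packings below, and these are used only in the limit \<open>N \<rightarrow> \<infinity>\<close>.
\<close>

definition bowen_dist ::
    "(nat \<Rightarrow> 'a metric) \<Rightarrow> (nat \<Rightarrow> 'a \<Rightarrow> 'a) \<Rightarrow> nat \<Rightarrow> 'a \<Rightarrow> 'a \<Rightarrow> real" where
  "bowen_dist d T n x y = Max ((\<lambda>j. mdist (d j) (orbit_map T j x) (orbit_map T j y)) ` {..<n})"

definition bowen_ball ::
    "(nat \<Rightarrow> 'a metric) \<Rightarrow> (nat \<Rightarrow> 'a \<Rightarrow> 'a) \<Rightarrow> nat \<Rightarrow> 'a \<Rightarrow> real \<Rightarrow> 'a set" where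
  "bowen_ball d T n x \<epsilon> = {y \<in> mspace (d 0). bowen_dist d T n x y < \<epsilon>}"

definition bowen_cball ::
    "(nat \<Rightarrow> 'a metric) \<Rightarrow> (nat \<Rightarrow> 'a \<Rightarrow> 'a) \<Rightarrow> nat \<Rightarrow> 'a \<Rightarrow> real \<Rightarrow> 'a set" where
  "bowen_cball d T n x \<epsilon> = {y \<in> mspace (d 0). bowen_dist d T n x y \<le> \<epsilon>}"

text \<open>
  Countable families of balls are indexed by arbitrary subsets \<open>I\<close> of the naturals, so finite
  (possibly empty) and infinite families are both covered. Sums of the nonnegative weights, and
  their infima and suprema, are taken in \<open>[0, \<infinity>]\<close>.
\<close>

definition weight_sum ::
    "(nat \<Rightarrow> 'a \<Rightarrow> 'a) \<Rightarrow> (nat \<Rightarrow> 'a \<Rightarrow> real) \<Rightarrow> real \<Rightarrow> nat set \<Rightarrow> (nat \<Rightarrow> nat) \<Rightarrow> (nat \<Rightarrow> 'a) \<Rightarrow> ennreal" where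
  "weight_sum T f s I n x =
     (\<Sum>\<^sub>\<infinity>i\<in>I. ennreal (exp (- real (n i) * s + birkhoff_sum T f (n i) (x i))))"

definition is_cover ::
    "(nat \<Rightarrow> 'a metric) \<Rightarrow> (nat \<Rightarrow> 'a \<Rightarrow> 'a) \<Rightarrow> nat \<Rightarrow> real \<Rightarrow> 'a set
      \<Rightarrow> nat set \<Rightarrow> (nat \<Rightarrow> nat) \<Rightarrow> (nat \<Rightarrow> 'a) \<Rightarrow> bool" where
  "is_cover d T N \<epsilon> Z I n x \<longleftrightarrow>
     (\<forall>i\<in>I. x i \<in> mspace (d 0) \<and> n i \<ge> N) \<and>
     Z \<subseteq> (\<Union>i\<in>I. bowen_ball d T (n i) (x i) \<epsilon>)"

definition bowen_R_N ::
    "(nat \<Rightarrow> 'a metric) \<Rightarrow> (nat \<Rightarrow> 'a \<Rightarrow> 'a) \<Rightarrow> (nat \<Rightarrow> 'a \<Rightarrow> real) \<Rightarrow> 'a set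
      \<Rightarrow> real \<Rightarrow> real \<Rightarrow> nat \<Rightarrow> ennreal" where
  "bowen_R_N d T f Z \<epsilon> s N = Inf {weight_sum T f s I n x | I n x. is_cover d T N \<epsilon> Z I n x}"

definition bowen_R ::
    "(nat \<Rightarrow> 'a metric) \<Rightarrow> (nat \<Rightarrow> 'a \<Rightarrow> 'a) \<Rightarrow> (nat \<Rightarrow> 'a \<Rightarrow> real) \<Rightarrow> 'a set
      \<Rightarrow> real \<Rightarrow> real \<Rightarrow> ennreal" where
  "bowen_R d T f Z \<epsilon> s = lim (\<lambda>N. bowen_R_N d T f Z \<epsilon> s N)"

definition bowen_pressure_at ::
    "(nat \<Rightarrow> 'a metric) \<Rightarrow> (nat \<Rightarrow> 'a \<Rightarrow> 'a) \<Rightarrow> (nat \<Rightarrow> 'a \<Rightarrow> real) \<Rightarrow> 'a set \<Rightarrow> real \<Rightarrow> ereal" where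
  "bowen_pressure_at d T f Z \<epsilon> = Inf {ereal s | s. bowen_R d T f Z \<epsilon> s = 0}"

definition bowen_pressure ::
    "(nat \<Rightarrow> 'a metric) \<Rightarrow> (nat \<Rightarrow> 'a \<Rightarrow> 'a) \<Rightarrow> (nat \<Rightarrow> 'a \<Rightarrow> real) \<Rightarrow> 'a set \<Rightarrow> ereal" where
  "bowen_pressure d T f Z = Lim (at_right 0) (\<lambda>\<epsilon>. bowen_pressure_at d T f Z \<epsilon>)"

definition bowen_entropy ::
    "(nat \<Rightarrow> 'a metric) \<Rightarrow> (nat \<Rightarrow> 'a \<Rightarrow> 'a) \<Rightarrow> 'a set \<Rightarrow> ereal" where
  "bowen_entropy d T Z = bowen_pressure d T (\<lambda>k x. 0) Z"

definition is_packing ::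
    "(nat \<Rightarrow> 'a metric) \<Rightarrow> (nat \<Rightarrow> 'a \<Rightarrow> 'a) \<Rightarrow> nat \<Rightarrow> real \<Rightarrow> 'a set
      \<Rightarrow> nat set \<Rightarrow> (nat \<Rightarrow> nat) \<Rightarrow> (nat \<Rightarrow> 'a) \<Rightarrow> bool" where
  "is_packing d T N \<epsilon> Z I n x \<longleftrightarrow>
     (\<forall>i\<in>I. x i \<in> Z \<and> n i \<ge> N) \<and>
     disjoint_family_on (\<lambda>i. bowen_cball d T (n i) (x i) \<epsilon>) I"

definition packing_P_N ::
    "(nat \<Rightarrow> 'a metric) \<Rightarrow> (nat \<Rightarrow> 'a \<Rightarrow> 'a) \<Rightarrow> (nat \<Rightarrow> 'a \<Rightarrow> real) \<Rightarrow> 'a set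
      \<Rightarrow> real \<Rightarrow> real \<Rightarrow> nat \<Rightarrow> ennreal" where
  "packing_P_N d T f Z \<epsilon> s N = Sup {weight_sum T f s I n x | I n x. is_packing d T N \<epsilon> Z I n x}"

definition packing_P_inf ::
    "(nat \<Rightarrow> 'a metric) \<Rightarrow> (nat \<Rightarrow> 'a \<Rightarrow> 'a) \<Rightarrow> (nat \<Rightarrow> 'a \<Rightarrow> real) \<Rightarrow> 'a set
      \<Rightarrow> real \<Rightarrow> real \<Rightarrow> ennreal" where
  "packing_P_inf d T f Z \<epsilon> s = lim (\<lambda>N. packing_P_N d T f Z \<epsilon> s N)"

definition packing_P ::
    "(nat \<Rightarrow> 'a metric) \<Rightarrow> (nat \<Rightarrow> 'a \<Rightarrow> 'a) \<Rightarrow> (nat \<Rightarrow> 'a \<Rightarrow> real) \<Rightarrow> 'a set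
      \<Rightarrow> real \<Rightarrow> real \<Rightarrow> ennreal" where
  "packing_P d T f Z \<epsilon> s =
     Inf {(\<Sum>i. packing_P_inf d T f (W i) \<epsilon> s) | W :: nat \<Rightarrow> 'a set.
            (\<forall>i. W i \<subseteq> mspace (d 0)) \<and> Z \<subseteq> (\<Union>i. W i)}"

definition packing_pressure_at ::
    "(nat \<Rightarrow> 'a metric) \<Rightarrow> (nat \<Rightarrow> 'a \<Rightarrow> 'a) \<Rightarrow> (nat \<Rightarrow> 'a \<Rightarrow> real) \<Rightarrow> 'a set \<Rightarrow> real \<Rightarrow> ereal" where
  "packing_pressure_at d T f Z \<epsilon> = Inf {ereal s | s. packing_P d T f Z \<epsilon> s = 0}"

definition packing_pressure ::
    "(nat \<Rightarrow> 'a metric) \<Rightarrow> (nat \<Rightarrow> 'a \<Rightarrow> 'a) \<Rightarrow> (nat \<Rightarrow> 'a \<Rightarrow> real) \<Rightarrow> 'a set \<Rightarrow> ereal" where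
  "packing_pressure d T f Z = Lim (at_right 0) (\<lambda>\<epsilon>. packing_pressure_at d T f Z \<epsilon>)"

definition packing_entropy ::
    "(nat \<Rightarrow> 'a metric) \<Rightarrow> (nat \<Rightarrow> 'a \<Rightarrow> 'a) \<Rightarrow> 'a set \<Rightarrow> ereal" where
  "packing_entropy d T Z = packing_pressure d T (\<lambda>k x. 0) Z"

text \<open>All four limits above are limits of monotone functions, so they exist.\<close>

lemma bowen_R_N_mono:
  assumes "M \<le> N"
  shows "bowen_R_N d T f Z \<epsilon> s M \<le> bowen_R_N d T f Z \<epsilon> s N"
proof -
  have *: "is_cover d T N \<epsilon> Z I n x \<Longrightarrow> is_cover d T M \<epsilon> Z I n x" for I n x
    using assms unfolding is_cover_def by (meson le_trans)
  show ?thesis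
    unfolding bowen_R_N_def
    by (intro Inf_superset_mono subsetI, elim CollectE exE conjE, intro CollectI exI conjI) (assumption, erule *)
qed

lemma packing_P_N_antimono:
  assumes "M \<le> N"
  shows "packing_P_N d T f Z \<epsilon> s N \<le> packing_P_N d T f Z \<epsilon> s M"
proof -
  have *: "is_packing d T N \<epsilon> Z I n x \<Longrightarrow> is_packing d T M \<epsilon> Z I n x" for I n x
    using assms unfolding is_packing_def by (meson le_trans)
  show ?thesis
    unfolding packing_P_N_def
    by (intro Sup_subset_mono subsetI, elim CollectE exE conjE, intro CollectI exI conjI) (assumption, erule *)
qed

lemma bowen_R_N_tendsto: "bowen_R_N d T f Z \<epsilon> s \<longlonglongrightarrow> bowen_R d T f Z \<epsilon> s"
proof -
  have "incseq (bowen_R_N d T f Z \<epsilon> s)"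
    by (simp add: incseq_def bowen_R_N_mono)
  from convergentI[OF LIMSEQ_SUP[OF this]] show ?thesis
    unfolding bowen_R_def convergent_LIMSEQ_iff .
qed

lemma packing_P_N_tendsto: "packing_P_N d T f Z \<epsilon> s \<longlonglongrightarrow> packing_P_inf d T f Z \<epsilon> s"
proof -
  have "decseq (packing_P_N d T f Z \<epsilon> s)"
    by (simp add: decseq_def packing_P_N_antimono)
  from convergentI[OF LIMSEQ_INF[OF this]] show ?thesis
    unfolding packing_P_inf_def convergent_LIMSEQ_iff .
qed

lemma bowen_pressure_at_antimono:
  assumes "\<epsilon> \<le> \<eta>"
  shows "bowen_pressure_at d T f Z \<eta> \<le> bowen_pressure_at d T f Z \<epsilon>"
proof -
  have "bowen_ball d T n x \<epsilon> \<subseteq> bowen_ball d T n x \<eta>" for n x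
    using assms by (auto simp: bowen_ball_def)
  then have *: "is_cover d T N \<epsilon> Z I n x \<Longrightarrow> is_cover d T N \<eta> Z I n x" for N I n x
    unfolding is_cover_def by (meson UN_mono order_refl subset_trans)
  have "bowen_R_N d T f Z \<eta> s N \<le> bowen_R_N d T f Z \<epsilon> s N" for s N
    unfolding bowen_R_N_def
    by (intro Inf_superset_mono subsetI, elim CollectE exE conjE, intro CollectI exI conjI) (assumption, erule *)
  then have "bowen_R d T f Z \<eta> s \<le> bowen_R d T f Z \<epsilon> s" for s
    by (intro lim_mono[OF _ bowen_R_N_tendsto bowen_R_N_tendsto])
  then have "bowen_R d T f Z \<epsilon> s = 0 \<Longrightarrow> bowen_R d T f Z \<eta> s = 0" for s
    by (metis le_zero_eq)
  then show ?thesis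
    unfolding bowen_pressure_at_def by (intro Inf_superset_mono Collect_mono) blast
qed

lemma packing_pressure_at_antimono:
  assumes "\<epsilon> \<le> \<eta>"
  shows "packing_pressure_at d T f Z \<eta> \<le> packing_pressure_at d T f Z \<epsilon>"
proof -
  have "bowen_cball d T n x \<epsilon> \<subseteq> bowen_cball d T n x \<eta>" for n x
    using assms by (auto simp: bowen_cball_def)
  then have *: "is_packing d T N \<eta> W I n x \<Longrightarrow> is_packing d T N \<epsilon> W I n x" for N W I n x
    unfolding is_packing_def disjoint_family_on_def by (metis Int_mono subset_empty)
  have "packing_P_N d T f W \<eta> s N \<le> packing_P_N d T f W \<epsilon> s N" for W s N
    unfolding packing_P_N_def
    by (intro Sup_subset_mono subsetI, elim CollectE exE conjE, intro CollectI exI conjI) (assumption, erule *)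
  then have "packing_P_inf d T f W \<eta> s \<le> packing_P_inf d T f W \<epsilon> s" for W s
    by (intro lim_mono[OF _ packing_P_N_tendsto packing_P_N_tendsto])
  then have *: "(\<Sum>i. packing_P_inf d T f (W i) \<eta> s) \<le> (\<Sum>i. packing_P_inf d T f (W i) \<epsilon> s)"
    for W :: "nat \<Rightarrow> 'a set" and s
    by (intro suminf_le) auto
  have "packing_P d T f Z \<eta> s \<le> packing_P d T f Z \<epsilon> s" for s
    unfolding packing_P_def
  proof (rule Inf_mono, elim CollectE exE conjE, hypsubst)
    fix W :: "nat \<Rightarrow> 'a set"
    assume "\<forall>i. W i \<subseteq> mspace (d 0)" and "Z \<subseteq> (\<Union>i. W i)"
    then show "\<exists>a\<in>{(\<Sum>i. packing_P_inf d T f (W i) \<eta> s) | W.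
                  (\<forall>i. W i \<subseteq> mspace (d 0)) \<and> Z \<subseteq> (\<Union>i. W i)}.
                a \<le> (\<Sum>i. packing_P_inf d T f (W i) \<epsilon> s)"
      by (intro bexI[where x = "\<Sum>i. packing_P_inf d T f (W i) \<eta> s"] * CollectI exI[of _ W]) simp
  qed
  then have "packing_P d T f Z \<epsilon> s = 0 \<Longrightarrow> packing_P d T f Z \<eta> s = 0" for s
    by (metis le_zero_eq)
  then show ?thesis
    unfolding packing_pressure_at_def by (intro Inf_superset_mono Collect_mono) blast
qed

lemma tendsto_at_right_antimono:
  fixes g :: "real \<Rightarrow> ereal"
  assumes "\<And>\<epsilon> \<eta>. \<epsilon> \<le> \<eta> \<Longrightarrow> g \<eta> \<le> g \<epsilon>"
  shows "(g \<longlongrightarrow> Lim (at_right 0) g) (at_right 0)"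
proof -
  have "(g \<longlongrightarrow> (SUP \<epsilon>\<in>{0<..}. g \<epsilon>)) (at_right 0)"
  proof (rule increasing_tendsto)
    show "eventually (\<lambda>\<epsilon>. g \<epsilon> \<le> (SUP \<epsilon>\<in>{0<..}. g \<epsilon>)) (at_right 0)"
      by (rule eventually_mono[OF eventually_at_right_less]) (simp add: SUP_upper)
    fix x assume "x < (SUP \<epsilon>\<in>{0<..}. g \<epsilon>)"
    then obtain \<eta> where "\<eta> > 0" and \<eta>: "x < g \<eta>"
      by (auto simp: less_SUP_iff)
    from eventually_at_right_real[OF \<open>\<eta> > 0\<close>]
    show "eventually (\<lambda>\<epsilon>. x < g \<epsilon>) (at_right 0)"
    proof (rule eventually_mono)
      fix \<epsilon> assume "\<epsilon> \<in> {0<..<\<eta>}"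
      with assms[of \<epsilon> \<eta>] \<eta> show "x < g \<epsilon>"
        by auto
    qed
  qed
  then show ?thesis
    by (simp add: tendsto_Lim)
qed

lemma bowen_pressure_tendsto:
  "(bowen_pressure_at d T f Z \<longlongrightarrow> bowen_pressure d T f Z) (at_right 0)"
  unfolding bowen_pressure_def by (intro tendsto_at_right_antimono bowen_pressure_at_antimono)

lemma packing_pressure_tendsto:
  "(packing_pressure_at d T f Z \<longlongrightarrow> packing_pressure d T f Z) (at_right 0)"
  unfolding packing_pressure_def by (intro tendsto_at_right_antimono packing_pressure_at_antimono)

end

theory Submission
  imports Defs
begin

text \<open>
  The weight of a family depends only on its centres and orders, not on the metrics. If
  \<open>d\<close>-distances below \<open>\<delta>\<close> force \<open>d'\<close>-distances below \<open>\<epsilon>\<close> at every time, then \<open>d\<close>-Bowen balls of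
  radius \<open>\<delta>\<close> lie in the concentric \<open>d'\<close>-Bowen balls of radius \<open>\<epsilon>\<close>. Hence the \<open>d\<close>-covers at scale
  \<open>\<delta>\<close> are \<open>d'\<close>-covers at scale \<open>\<epsilon>\<close>, and the \<open>d'\<close>-packings at scale \<open>\<epsilon>\<close> are \<open>d\<close>-packings at scale
  \<open>\<delta>/2\<close>. So each pressure for \<open>d'\<close> at scale \<open>\<epsilon>\<close> is at most the one for \<open>d\<close> at some smaller scale.
\<close>

text \<open>Antimonotonicity makes every value \<open>h \<delta>\<close> with
  \<open>\<delta> > 0\<close> a lower bound for the limit of \<open>h\<close> at 0. So the limit of
  \<open>h\<close> bounds every \<open>g \<epsilon>\<close>, hence also their limit.\<close>

lemma Lim_at_right_antimono_le:
  fixes g h :: "real \<Rightarrow> ereal"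
  assumes g: "\<And>\<epsilon> \<eta>. \<epsilon> \<le> \<eta> \<Longrightarrow> g \<eta> \<le> g \<epsilon>"
    and h: "\<And>\<epsilon> \<eta>. \<epsilon> \<le> \<eta> \<Longrightarrow> h \<eta> \<le> h \<epsilon>"
    and le: "\<And>\<epsilon>. \<epsilon> > 0 \<Longrightarrow> \<exists>\<delta>>0. g \<epsilon> \<le> h \<delta>"
  shows "Lim (at_right 0) g \<le> Lim (at_right 0) h"
proof (rule tendsto_upperbound[OF tendsto_at_right_antimono[OF g]])
  have h_le: "h \<delta> \<le> Lim (at_right 0) h" if "\<delta> > 0" for \<delta>
  proof (rule tendsto_lowerbound[OF tendsto_at_right_antimono[OF h]])
    show "\<forall>\<^sub>F \<eta> in at_right 0. h \<delta> \<le> h \<eta>"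
      using eventually_at_right_real[OF that] by (rule eventually_mono) (auto intro: h)
  qed simp_all
  show "\<forall>\<^sub>F \<epsilon> in at_right 0. g \<epsilon> \<le> Lim (at_right 0) h"
    by (rule eventually_mono[OF eventually_at_right_less]) (blast dest: le intro: h_le order_trans)
qed simp_all

lemma orbit_map_in_mspace:
  assumes "nds X T" "metrics_for X d" "x \<in> mspace (d 0)"
  shows "orbit_map T j x \<in> mspace (d j)"
proof (induction j)
  case (Suc j)
  have "topspace (X k) = mspace (d k)" for k
    using assms(2) by (metis metrics_for_def topspace_mtopology_of)
  moreover have "continuous_map (X j) (X (Suc j)) (T j)"
    using assms(1) by (simp add: nds_def)
  ultimately show ?case
    using Suc by (fastforce simp: continuous_map_def)
qed (use assms in simp)

text \<open>Equicontinuity of the identities at one fixed pair of scales, read along orbits, which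
  is where Bowen distances look. The carrier equation is included because Bowen balls are cut out of
  \<open>mspace (d 0)\<close> and \<open>mspace (d' 0)\<close>.\<close>

definition dominates_at ::
    "(nat \<Rightarrow> 'a metric) \<Rightarrow> (nat \<Rightarrow> 'a metric) \<Rightarrow> (nat \<Rightarrow> 'a \<Rightarrow> 'a) \<Rightarrow> real \<Rightarrow> real \<Rightarrow> bool" where
  "dominates_at d d' T \<delta> \<epsilon> \<longleftrightarrow> mspace (d' 0) = mspace (d 0) \<and>
     (\<forall>j. \<forall>x\<in>mspace (d 0). \<forall>y\<in>mspace (d 0).
        mdist (d j) (orbit_map T j x) (orbit_map T j y) < \<delta> \<longrightarrow>
        mdist (d' j) (orbit_map T j x) (orbit_map T j y) < \<epsilon>)"

lemma dominates_at_exists: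
  assumes "nds X T" "metrics_for X d" "metrics_for X d'"
    and "equicontinuous_maps d d' (\<lambda>k. id)" and "\<epsilon> > 0"
  shows "\<exists>\<delta>>0. dominates_at d d' T \<delta> \<epsilon>"
proof -
  \<comment> \<open>One \<open>\<delta>\<close> serves all times \<open>k\<close>, so it will not
    depend on the order of a Bowen ball.\<close>
  obtain \<delta> where "\<delta> > 0" and \<delta>: "\<And>k x y. x \<in> mspace (d k) \<Longrightarrow> y \<in> mspace (d k) \<Longrightarrow>
      mdist (d k) x y < \<delta> \<Longrightarrow> mdist (d' k) x y < \<epsilon>"
    using assms(4,5) unfolding equicontinuous_maps_def id_apply by meson
  have "mspace (d' 0) = mspace (d 0)"
    using assms(2,3) by (metis metrics_for_def topspace_mtopology_of)
  with \<open>\<delta> > 0\<close> \<delta> show ?thesis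
    unfolding dominates_at_def using orbit_map_in_mspace[OF assms(1,2)] by blast
qed

text \<open>For \<open>n \<ge> 1\<close> the \<open>Max\<close> is over a nonempty finite set, so it
  is attained.\<close>

lemma bowen_dist_less_iff:
  assumes "n \<ge> 1"
  shows "bowen_dist d T n x y < \<epsilon> \<longleftrightarrow>
    (\<forall>j<n. mdist (d j) (orbit_map T j x) (orbit_map T j y) < \<epsilon>)"
  unfolding bowen_dist_def using assms by (subst Max_less_iff) (auto simp: lessThan_empty_iff)

lemma bowen_dist_less:
  assumes "dominates_at d d' T \<delta> \<epsilon>" "n \<ge> 1" "x \<in> mspace (d 0)" "y \<in> mspace (d 0)"
    and "bowen_dist d T n x y < \<delta>"
  shows "bowen_dist d' T n x y < \<epsilon>"
  using assms(1,3,4,5) unfolding bowen_dist_less_iff[OF assms(2)] dominates_at_def by blast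

lemma bowen_ball_subset:
  assumes "dominates_at d d' T \<delta> \<epsilon>" "n \<ge> 1" "x \<in> mspace (d 0)"
  shows "bowen_ball d T n x \<delta> \<subseteq> bowen_ball d' T n x \<epsilon>"
  using assms bowen_dist_less[OF assms] by (auto simp: bowen_ball_def dominates_at_def)

text \<open>The strict gap \<open>\<eta> < \<delta>\<close> turns the closed condition
  \<open>\<le> \<eta>\<close> into the strict one that \<open>dominates_at\<close> requires.\<close>

lemma bowen_cball_subset:
  assumes "dominates_at d d' T \<delta> \<epsilon>" "\<eta> < \<delta>" "n \<ge> 1" "x \<in> mspace (d 0)"
  shows "bowen_cball d T n x \<eta> \<subseteq> bowen_cball d' T n x \<epsilon>"
proof
  fix y assume y: "y \<in> bowen_cball d T n x \<eta>"
  then have "bowen_dist d T n x y < \<delta>" "y \<in> mspace (d 0)"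
    using assms(2) by (auto simp: bowen_cball_def)
  then have "bowen_dist d' T n x y < \<epsilon>"
    using bowen_dist_less[OF assms(1,3,4)] by simp
  with \<open>y \<in> mspace (d 0)\<close> show "y \<in> bowen_cball d' T n x \<epsilon>"
    using assms(1) by (auto simp: bowen_cball_def dominates_at_def)
qed

lemma bowen_pressure_at_le:
  assumes dom: "dominates_at d d' T \<delta> \<epsilon>"
  shows "bowen_pressure_at d' T f Z \<epsilon> \<le> bowen_pressure_at d T f Z \<delta>"
proof -
  \<comment> \<open>\<open>N \<ge> 1\<close> keeps all orders \<open>n i\<close> positive, away from
    the \<open>Max\<close> of an empty set. The limit in \<open>N\<close> is then compared from
    index 1 on.\<close>
  have cover: "is_cover d' T N \<epsilon> Z I n x"
    if "N \<ge> 1" and c: "is_cover d T N \<delta> Z I n x" for N I n x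
  proof -
    have ball: "bowen_ball d T (n i) (x i) \<delta> \<subseteq> bowen_ball d' T (n i) (x i) \<epsilon>" if "i \<in> I" for i
      using that c \<open>N \<ge> 1\<close> by (intro bowen_ball_subset[OF dom]) (auto simp: is_cover_def intro: le_trans)
    have "Z \<subseteq> (\<Union>i\<in>I. bowen_ball d T (n i) (x i) \<delta>)"
      using c by (simp add: is_cover_def)
    also have "\<dots> \<subseteq> (\<Union>i\<in>I. bowen_ball d' T (n i) (x i) \<epsilon>)"
      by (intro UN_mono ball) simp_all
    finally show ?thesis
      using c dom by (simp add: is_cover_def dominates_at_def)
  qed
  have "bowen_R_N d' T f Z \<epsilon> s N \<le> bowen_R_N d T f Z \<delta> s N" if "N \<ge> 1" for s N
    unfolding bowen_R_N_def using cover[OF that] by (intro Inf_superset_mono) blast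
  then have "bowen_R d' T f Z \<epsilon> s \<le> bowen_R d T f Z \<delta> s" for s
    by (intro lim_mono[OF _ bowen_R_N_tendsto bowen_R_N_tendsto, of 1])
  \<comment> \<open>Values lie in \<open>[0, \<infinity>]\<close>, so a bound by 0 forces 0. Every
    exponent admissible for \<open>d\<close> is thus admissible for \<open>d'\<close>, and the
    infimum for \<open>d'\<close> is the smaller one.\<close>
  then have "bowen_R d T f Z \<delta> s = 0 \<Longrightarrow> bowen_R d' T f Z \<epsilon> s = 0" for s
    by (metis le_zero_eq)
  then show ?thesis
    unfolding bowen_pressure_at_def by (intro Inf_superset_mono) blast
qed

lemma packing_pressure_at_le:
  assumes dom: "dominates_at d d' T \<delta> \<epsilon>" and "\<eta> < \<delta>"
  shows "packing_pressure_at d' T f Z \<epsilon> \<le> packing_pressure_at d T f Z \<eta>"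
proof -
  have space: "mspace (d' 0) = mspace (d 0)"
    using dom by (simp add: dominates_at_def)
  \<comment> \<open>Shrinking the balls preserves disjointness. Centres lie in \<open>W\<close>, so
    \<open>W \<subseteq> mspace (d 0)\<close> is what puts them in the carrier.\<close>
  have packing: "is_packing d T N \<eta> W I n x"
    if "N \<ge> 1" and W: "W \<subseteq> mspace (d 0)" and p: "is_packing d' T N \<epsilon> W I n x" for W N I n x
  proof -
    have "bowen_cball d T (n i) (x i) \<eta> \<subseteq> bowen_cball d' T (n i) (x i) \<epsilon>" if "i \<in> I" for i
      using that p W \<open>N \<ge> 1\<close>
      by (intro bowen_cball_subset[OF dom \<open>\<eta> < \<delta>\<close>]) (auto simp: is_packing_def intro: le_trans)
    then show ?thesis
      using p unfolding is_packing_def disjoint_family_on_def by blast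
  qed
  have "packing_P_N d' T f W \<epsilon> s N \<le> packing_P_N d T f W \<eta> s N"
    if "N \<ge> 1" "W \<subseteq> mspace (d 0)" for W s N
    unfolding packing_P_N_def using packing[OF that] by (intro Sup_subset_mono) blast
  then have P_inf: "packing_P_inf d' T f W \<epsilon> s \<le> packing_P_inf d T f W \<eta> s"
    if "W \<subseteq> mspace (d 0)" for W s
    using that by (intro lim_mono[OF _ packing_P_N_tendsto packing_P_N_tendsto, of 1])
  have "packing_P d' T f Z \<epsilon> s \<le> packing_P d T f Z \<eta> s" for s
    unfolding packing_P_def
  proof (rule Inf_mono, elim CollectE exE conjE, hypsubst)
    fix W :: "nat \<Rightarrow> 'a set"
    \<comment> \<open>The same decomposition \<open>W\<close> competes in the infimum for
      \<open>d'\<close>, with a termwise smaller sum.\<close>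
    assume W: "\<forall>i. W i \<subseteq> mspace (d 0)" and "Z \<subseteq> (\<Union>i. W i)"
    moreover have "(\<Sum>i. packing_P_inf d' T f (W i) \<epsilon> s) \<le> (\<Sum>i. packing_P_inf d T f (W i) \<eta> s)"
      using W P_inf by (intro suminf_le) auto
    ultimately show "\<exists>a\<in>{(\<Sum>i. packing_P_inf d' T f (W i) \<epsilon> s) | W.
                  (\<forall>i. W i \<subseteq> mspace (d' 0)) \<and> Z \<subseteq> (\<Union>i. W i)}.
                a \<le> (\<Sum>i. packing_P_inf d T f (W i) \<eta> s)"
      unfolding space by blast
  qed
  then have "packing_P d T f Z \<eta> s = 0 \<Longrightarrow> packing_P d' T f Z \<epsilon> s = 0" for s
    by (metis le_zero_eq)
  then show ?thesis
    unfolding packing_pressure_at_def by (intro Inf_superset_mono) blast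
qed

lemma pressure_le:
  assumes "nds X T" "metrics_for X d" "metrics_for X d'"
    and "equicontinuous_maps d d' (\<lambda>k. id)"
  shows bowen_pressure_le: "bowen_pressure d' T f Z \<le> bowen_pressure d T f Z"
    and packing_pressure_le: "packing_pressure d' T f Z \<le> packing_pressure d T f Z"
proof -
  show "bowen_pressure d' T f Z \<le> bowen_pressure d T f Z"
    unfolding bowen_pressure_def
    using dominates_at_exists[OF assms] bowen_pressure_at_le
    by (intro Lim_at_right_antimono_le bowen_pressure_at_antimono) blast+
  have "\<exists>\<eta>>0. packing_pressure_at d' T f Z \<epsilon> \<le> packing_pressure_at d T f Z \<eta>" if "\<epsilon> > 0" for \<epsilon>
  proof -
    obtain \<delta> where "\<delta> > 0" "dominates_at d d' T \<delta> \<epsilon>"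
      using dominates_at_exists[OF assms \<open>\<epsilon> > 0\<close>] by blast
    then show ?thesis
      using packing_pressure_at_le[of d d' T \<delta> \<epsilon> "\<delta> / 2"] by (intro exI[of _ "\<delta> / 2"]) simp
  qed
  then show "packing_pressure d' T f Z \<le> packing_pressure d T f Z"
    unfolding packing_pressure_def
    by (intro Lim_at_right_antimono_le packing_pressure_at_antimono)
qed

theorem theorem4p3:
  fixes X :: "nat \<Rightarrow> 'a topology"
    and T :: "nat \<Rightarrow> 'a \<Rightarrow> 'a"
    and d d' :: "nat \<Rightarrow> 'a metric"
  assumes "nds X T"
    and "metrics_for X d"
    and "metrics_for X d'"
    and "uniformly_equivalent d d'"
  shows "(\<forall>f\<in>cont_seqs X. \<forall>Z\<subseteq>topspace (X 0). equicontinuous_seq d f \<longrightarrow>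
            bowen_pressure d T f Z = bowen_pressure d' T f Z \<and>
            packing_pressure d T f Z = packing_pressure d' T f Z) \<and>
         (\<forall>Z\<subseteq>topspace (X 0).
            bowen_entropy d T Z = bowen_entropy d' T Z \<and>
            packing_entropy d T Z = packing_entropy d' T Z)"
proof -
  have equi: "equicontinuous_maps d d' (\<lambda>k. id)" "equicontinuous_maps d' d (\<lambda>k. id)"
    using assms(4) by (simp_all add: uniformly_equivalent_def)
  \<comment> \<open>Exchanging the roles of \<open>d\<close> and \<open>d'\<close> gives both
    inequalities. The entropies are the case of the zero sequence.\<close>
  have "bowen_pressure d T f Z = bowen_pressure d' T f Z"
    and "packing_pressure d T f Z = packing_pressure d' T f Z" for f Z
    using pressure_le[OF assms(1-3) equi(1)] pressure_le[OF assms(1,3,2) equi(2)]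
    by (auto intro: order_antisym)
  then show ?thesis
    by (simp add: bowen_entropy_def packing_entropy_def)
qed

end
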